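(* Let $\Sigma$ and $Z$ be sets and let $f: Z \times \Sigma^n \to \{0,1\}$ be a partial function. Suppose there exists a $(\rho_0,\rho_1)$-robust local algorithm $M$ for computing $f$ with query complexity $\ell$ (and error rate $1/3$), where $\max\{\rho_0,\rho_1\} = \Omega(1)$. Then there exists a sample-based algorithm $N$ for $f$ (with error rate $1/3$) with sample complexity $\gamma \cdot n^{1-1/(2q^2)}$, where $q = O(\ell \log \ell)$ and $\gamma = O(|\Sigma|^q \ln |\Sigma|)$.
   Context: A $q$-local algorithm $M$ for computing a partial function $f: Z\times\Sigma^n\to\{0,1\}$ with error rate $\sigma$ is a randomised algorithm that receives explicit access to $z \in Z$ and query access to $x \in \Sigma^n$, makes at most $q$ queries to $x$ (possibly adaptively), and satisfies $\Pr[M^x(z) = f(z,x)] \ge 1-\sigma$ for every $(z,x)$ in the domain of $f$; when unstated, the error rate is $1/3$. The relative distance of $x,y\in\Sigma^n$ is the fraction of coordinates where they differ, and $B_\rho(x)$ denotes the set of strings at relative distance at most $\rho$ from $x$. $M$ is $\rho$-robust at $x$ if $\Pr[M^w(z) = f(z,x)] \ge 1-\sigma$ for all $w \in B_\rho(x)$ and $z \in Z$; $M$ is $(\rho_0,\rho_1)$-robust if for every $z$ and $b\in\{0,1\}$, $M$ is $\rho_b$-robust at every $x$ with $f(z,x)=b$. A sample-based algorithm queries each coordinate of its input independently with some fixed probability $p$ (and may abort/cap when the number of sampled coordinates exceeds a bound); its sample complexity is the bound on the number of coordinates it samples. Asymptotic notation is with respect to $n \to \infty$. *)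

theory Defs
  imports "HOL-Probability.Probability"
begin

(* Sigma^n: strings are functions on {..<n}, extended by undefined elsewhere. *)
definition strings :: "nat \<Rightarrow> 'a set \<Rightarrow> (nat \<Rightarrow> 'a) set" where
  "strings n \<Sigma> = ({..<n} \<rightarrow>\<^sub>E \<Sigma>)"

definition rel_dist :: "nat \<Rightarrow> (nat \<Rightarrow> 'a) \<Rightarrow> (nat \<Rightarrow> 'a) \<Rightarrow> real" where
  "rel_dist n x y = real (card {i. i < n \<and> x i \<noteq> y i}) / real n"

definition string_ball :: "nat \<Rightarrow> 'a set \<Rightarrow> real \<Rightarrow> (nat \<Rightarrow> 'a) \<Rightarrow> (nat \<Rightarrow> 'a) set" where
  "string_ball n \<Sigma> \<rho> x = {w \<in> strings n \<Sigma>. rel_dist n x w \<le> \<rho>}"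

(* Partial functions from Z x Sigma^n to {0,1}; the bits 0 and 1 are False and True. *)
definition partial_fun ::
  "nat \<Rightarrow> 'a set \<Rightarrow> 'z set \<Rightarrow> ('z \<times> (nat \<Rightarrow> 'a) \<rightharpoonup> bool) \<Rightarrow> bool" where
  "partial_fun n \<Sigma> Z f \<longleftrightarrow> dom f \<subseteq> Z \<times> strings n \<Sigma>"

datatype 'a dtree = Output bool | Query nat "'a \<Rightarrow> 'a dtree"

primrec run :: "'a dtree \<Rightarrow> (nat \<Rightarrow> 'a) \<Rightarrow> bool" where
  "run (Output b) x = b"
| "run (Query i k) x = run (k (x i)) x"

primrec queries :: "'a dtree \<Rightarrow> (nat \<Rightarrow> 'a) \<Rightarrow> nat list" where
  "queries (Output b) x = []"
| "queries (Query i k) x = i # queries (k (x i)) x"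

(* A randomised algorithm with explicit input z is a distribution over deterministic adaptive
   query strategies (decision trees). For a finite alphabet and a bounded number of queries
   there are only finitely many such strategies up to behaviour on Sigma^n, so discrete
   distributions lose no generality. *)
type_synonym ('z, 'a) rand_alg = "'z \<Rightarrow> 'a dtree pmf"

definition output_prob :: "('z, 'a) rand_alg \<Rightarrow> 'z \<Rightarrow> (nat \<Rightarrow> 'a) \<Rightarrow> bool \<Rightarrow> real" where
  "output_prob M z x b = measure_pmf.prob (M z) {t. run t x = b}"

definition local_algorithm ::
  "nat \<Rightarrow> 'a set \<Rightarrow> 'z set \<Rightarrow> ('z \<times> (nat \<Rightarrow> 'a) \<rightharpoonup> bool) \<Rightarrow> nat \<Rightarrow> real \<Rightarrow> ('z, 'a) rand_alg \<Rightarrow> bool"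
where
  "local_algorithm n \<Sigma> Z f q \<sigma> M \<longleftrightarrow>
     (\<forall>z\<in>Z. \<forall>t\<in>set_pmf (M z). \<forall>x\<in>strings n \<Sigma>.
        length (queries t x) \<le> q \<and> set (queries t x) \<subseteq> {..<n}) \<and>
     (\<forall>z x b. f (z, x) = Some b \<longrightarrow> output_prob M z x b \<ge> 1 - \<sigma>)"

(* Robustness at x, for the explicit inputs in Z at which f is defined together with x. *)
definition robust_at ::
  "nat \<Rightarrow> 'a set \<Rightarrow> 'z set \<Rightarrow> ('z \<times> (nat \<Rightarrow> 'a) \<rightharpoonup> bool) \<Rightarrow> real \<Rightarrow> ('z, 'a) rand_alg \<Rightarrow>
   real \<Rightarrow> (nat \<Rightarrow> 'a) \<Rightarrow> bool"
where
  "robust_at n \<Sigma> Z f \<sigma> M \<rho> x \<longleftrightarrow>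
     (\<forall>w\<in>string_ball n \<Sigma> \<rho> x. \<forall>z\<in>Z. \<forall>b. f (z, x) = Some b \<longrightarrow> output_prob M z w b \<ge> 1 - \<sigma>)"

(* The radius depends on the value f(z,x), so robustness is required of M with that explicit
   input z fixed, i.e. of robust_at with the singleton {z} as set of explicit inputs. *)
definition robust ::
  "nat \<Rightarrow> 'a set \<Rightarrow> 'z set \<Rightarrow> ('z \<times> (nat \<Rightarrow> 'a) \<rightharpoonup> bool) \<Rightarrow> real \<Rightarrow> ('z, 'a) rand_alg \<Rightarrow>
   real \<Rightarrow> real \<Rightarrow> bool"
where
  "robust n \<Sigma> Z f \<sigma> M \<rho>\<^sub>0 \<rho>\<^sub>1 \<longleftrightarrow>
     (\<forall>z\<in>Z. \<forall>b. \<forall>x. f (z, x) = Some b \<longrightarrow>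
        robust_at n \<Sigma> {z} f \<sigma> M (if b then \<rho>\<^sub>1 else \<rho>\<^sub>0) x)"

definition random_subset :: "nat \<Rightarrow> real \<Rightarrow> nat set pmf" where
  "random_subset n p =
     map_pmf (\<lambda>c. {i. i < n \<and> c i}) (Pi_pmf {..<n} False (\<lambda>_. bernoulli_pmf p))"

(* A sample-based algorithm sees z and the sampled coordinates with their values, as a finite
   map, and outputs a possibly random bit. If more than s coordinates are sampled it aborts;
   the result None is distinct from both bits, so aborting always counts as an error. *)
type_synonym ('z, 'a) sample_rule = "'z \<Rightarrow> (nat \<rightharpoonup> 'a) \<Rightarrow> bool pmf"

definition sample_run ::
  "nat \<Rightarrow> real \<Rightarrow> real \<Rightarrow> ('z, 'a) sample_rule \<Rightarrow> 'z \<Rightarrow> (nat \<Rightarrow> 'a) \<Rightarrow> bool option pmf"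
where
  "sample_run n p s N z x =
     bind_pmf (random_subset n p)
       (\<lambda>S. if real (card S) \<le> s then map_pmf Some (N z ((Some \<circ> x) |` S)) else return_pmf None)"

(* The sampling probability p, the sample complexity s and the rule N make up the algorithm;
   p and s do not depend on the explicit input. *)
definition sample_based_algorithm ::
  "nat \<Rightarrow> ('z \<times> (nat \<Rightarrow> 'a) \<rightharpoonup> bool) \<Rightarrow> real \<Rightarrow> real \<Rightarrow> real \<Rightarrow> ('z, 'a) sample_rule \<Rightarrow> bool"
where
  "sample_based_algorithm n f s \<sigma> p N \<longleftrightarrow>
     0 \<le> p \<and> p \<le> 1 \<and>
     (\<forall>z x b. f (z, x) = Some b \<longrightarrow>
        measure_pmf.prob (sample_run n p s N z x) {Some b} \<ge> 1 - \<sigma>)"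

(* O(l log l) as an explicit bound with constant C. The maximum keeps it positive for l <= 1,
   where l log l vanishes; an algorithm with at most one query is in particular a 2-local one. *)
definition l_log_l_bound :: "real \<Rightarrow> nat \<Rightarrow> real" where
  "l_log_l_bound C l = C * (real (max 2 l) * ln (real (max 2 l)))"

end

theory Submission
  imports Defs
begin

text \<open>
  Call the degree of a coordinate the probability that the decision tree drawn by \<open>M\<close> queries it on
  some input, and cut the coordinates at geometrically growing degrees into \<open>12 L\<close> rings, where
  \<open>L = max 2 l\<close>.  A tree makes at most \<open>L\<close> queries, so for every input some ring is missed with
  probability at least \<open>11/12\<close>; hence no amplification of \<open>M\<close> is needed.  If \<open>b\<close> is the value at which
  \<open>M\<close> is \<open>\<rho>\<close>-robust, the sampler looks for a string \<open>y\<close> consistent with the sample \<open>Q\<close> and a ring such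
  that the trees which reject \<open>y\<close> (output \<open>\<not> b\<close>) and miss the ring seem to have probability above \<open>1/2\<close>.
  The coordinates above the ring (the kernel) are read from \<open>y\<close>, those below it must lie in \<open>Q\<close>, and
  a tree with \<open>m\<close> queries below the ring gets weight \<open>p ^ (- m)\<close>, which makes the estimate unbiased.

  If the value is \<open>\<not> b\<close>, then \<open>y = x\<close> and the ring most often missed pass the test, by Chebyshev.
  If the value is \<open>b\<close>, the estimate depends on \<open>y\<close> only through the kernel, which has at most \<open>\<rho> n\<close>
  elements; by robustness its mean is at most \<open>1/3\<close>.  Coordinates below the ring have degree smaller
  than \<open>\<delta>\<close>, and the \<open>k\<close>-th moment with \<open>k\<close> of order \<open>p ^ L / (L \<delta>)\<close> gives an error exponentially small
  in \<open>k\<close>.  This beats the union bound over the assignments to the kernel since its size is inversely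
  proportional to the next, much larger, degree threshold.
\<close>

section \<open>Random subsets with independent inclusion\<close>

lemma set_pmf_random_subset: "set_pmf (random_subset n p) \<subseteq> Pow {..<n}"
  by (auto simp: random_subset_def)

lemma prob_random_subset_superset:
  assumes "U \<subseteq> {..<n}" "0 \<le> p" "p \<le> 1"
  shows "measure_pmf.prob (random_subset n p) {Q. U \<subseteq> Q} = p ^ card U"
proof -
  have "measure_pmf.prob (random_subset n p) {Q. U \<subseteq> Q} =
    measure_pmf.prob (Pi_pmf {..<n} False (\<lambda>_. bernoulli_pmf p))
      (Pi {..<n} (\<lambda>i. if i \<in> U then {True} else UNIV))"
    unfolding random_subset_def measure_map_pmf
    by (rule arg_cong[where f = "measure_pmf.prob _"])
      (use assms(1) in \<open>auto simp: Pi_def subset_iff split: if_splits\<close>)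
  also have "\<dots> = (\<Prod>i<n. if i \<in> U then p else 1)"
    using assms by (subst measure_Pi_pmf_Pi) (auto intro!: prod.cong simp: measure_pmf_single)
  also have "\<dots> = p ^ card U"
    using assms(1) by (simp add: prod.If_cases Int_absorb1)
  finally show ?thesis .
qed

text \<open>As a finite sum, the expectation over samples can be swapped with the expectation over
  trees by additivity, without a Fubini argument.\<close>

lemma expectation_random_subset:
  fixes g :: "nat set \<Rightarrow> real"
  shows "measure_pmf.expectation (random_subset n p) g =
    (\<Sum>Q\<in>Pow {..<n}. g Q * pmf (random_subset n p) Q)"
  using set_pmf_random_subset by (intro integral_measure_pmf_real) auto

lemma integrable_random_subset:
  fixes g :: "nat set \<Rightarrow> real"
  shows "integrable (measure_pmf (random_subset n p)) g"
  by (rule integrable_measure_pmf_finite)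
    (use set_pmf_random_subset in \<open>auto intro: finite_subset\<close>)

text \<open>Markov's inequality is enough here: with the cap set to 12 times the mean, aborting
  costs only 1/12.\<close>

lemma prob_card_random_subset_gt:
  assumes "0 \<le> p" "p \<le> 1" "0 < s"
  shows "measure_pmf.prob (random_subset n p) {Q. real (card Q) > s} \<le> real n * p / s"
proof -
  let ?R = "random_subset n p"
  have "measure_pmf.expectation ?R (\<lambda>Q. real (card Q)) =
    measure_pmf.expectation ?R (\<lambda>Q. \<Sum>i<n. indicator {Q. {i} \<subseteq> Q} Q)"
  proof (rule integral_cong_AE; (simp; fail)?; intro AE_pmfI)
    fix Q assume "Q \<in> set_pmf ?R"
    then have "Q \<subseteq> {..<n}" using set_pmf_random_subset by blast
    then show "real (card Q) = (\<Sum>i<n. indicator {Q. {i} \<subseteq> Q} Q)"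
      by (simp add: indicator_def sum.If_cases Int_absorb1)
  qed
  also have "\<dots> = (\<Sum>i<n. measure_pmf.prob ?R {Q. {i} \<subseteq> Q})"
    by (subst Bochner_Integration.integral_sum) (auto intro: integrable_random_subset)
  also have "\<dots> = (\<Sum>i<n. p)"
    using assms by (intro sum.cong) (auto simp: prob_random_subset_superset[of "{_}", simplified])
  finally have E: "measure_pmf.expectation ?R (\<lambda>Q. real (card Q)) = real n * p" by simp
  have "measure_pmf.prob ?R {Q. real (card Q) > s} \<le>
    measure_pmf.prob ?R {Q \<in> space (measure_pmf ?R). real (card Q) \<ge> s}"
    by (intro measure_pmf.finite_measure_mono) auto
  also have "\<dots> \<le> real n * p / s"
    unfolding E[symmetric] using assms
    by (intro integral_Markov_inequality_measure[where A = "{}"]) (auto intro: integrable_random_subset)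
  finally show ?thesis .
qed

section \<open>Inverse-probability weights and the tails of the resulting estimator\<close>

definition hit_weight :: "real \<Rightarrow> nat set \<Rightarrow> nat set \<Rightarrow> real" where
  "hit_weight p U Q = (if U \<subseteq> Q then inverse p ^ card U else 0)"

lemma hit_weight_nonneg: "0 < p \<Longrightarrow> 0 \<le> hit_weight p U Q"
  by (simp add: hit_weight_def)

lemma expectation_hit_weight:
  assumes "U \<subseteq> {..<n}" "0 < p" "p \<le> 1"
  shows "measure_pmf.expectation (random_subset n p) (hit_weight p U) = 1"
proof -
  have "hit_weight p U = (\<lambda>Q. inverse p ^ card U * indicator {Q. U \<subseteq> Q} Q)"
    by (auto simp: hit_weight_def fun_eq_iff)
  then show ?thesis using assms
    by (simp add: prob_random_subset_superset power_inverse)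
qed

text \<open>The common coordinates are paid for twice on the left but only once in the weight of the
  union.\<close>

lemma hit_weight_mult:
  assumes "finite U" "finite V" "0 < p"
  shows "hit_weight p U Q * hit_weight p V Q =
    inverse p ^ card (U \<inter> V) * hit_weight p (U \<union> V) Q"
  using card_Un_Int[OF assms(1,2)] by (simp add: hit_weight_def add.commute flip: power_add)

text \<open>In the application \<open>G\<close> consists of trees that avoid a ring and
  \<open>A t\<close> holds the queries that have to be found in the sample; low degree makes two
  such sets rarely meet.\<close>

locale sparse_family =
  fixes n l :: nat and p \<delta> :: real and T :: "'t pmf" and G :: "'t set" and A :: "'t \<Rightarrow> nat set"
  assumes p_pos: "0 < p" and p_le_1: "p \<le> 1"
    and A_subset: "\<And>t. t \<in> set_pmf T \<Longrightarrow> A t \<subseteq> {..<n}"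
    and card_A: "\<And>t. t \<in> set_pmf T \<Longrightarrow> card (A t) \<le> l"
    and degree: "\<And>i. measure_pmf.prob T {t \<in> G. i \<in> A t} \<le> \<delta>"
begin

definition \<mu> :: real where "\<mu> = measure_pmf.prob T G"

text \<open>The Horvitz-Thompson estimator of \<open>\<mu>\<close>.\<close>

definition Y :: "nat set \<Rightarrow> real" where
  "Y Q = measure_pmf.expectation T (\<lambda>t. indicator G t * hit_weight p (A t) Q)"

lemma delta_nonneg: "0 \<le> \<delta>"
  using degree[of 0] measure_nonneg[of "measure_pmf T"] by (metis order_trans)

lemma inverse_p_ge_1: "1 \<le> inverse p"
  using p_pos p_le_1 by (simp add: one_le_inverse)

lemma hit_weight_le:
  assumes "t \<in> set_pmf T"
  shows "hit_weight p (A t) Q \<le> inverse p ^ l"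
  using power_increasing[OF card_A[OF assms] inverse_p_ge_1] p_pos by (auto simp: hit_weight_def)

lemma integrable_weights:
  "integrable (measure_pmf T) (\<lambda>t. indicator G t * hit_weight p (A t) Q)"
proof (rule measure_pmf.integrable_const_bound[where B = "inverse p ^ l"])
  show "AE t in measure_pmf T. norm (indicator G t * hit_weight p (A t) Q) \<le> inverse p ^ l"
    using hit_weight_le hit_weight_nonneg[OF p_pos] p_pos by (intro AE_pmfI) (auto simp: indicator_def)
qed simp

lemma Y_nonneg: "0 \<le> Y Q"
  unfolding Y_def using hit_weight_nonneg[OF p_pos] by (intro integral_nonneg_AE AE_pmfI) auto

lemma integrable_overlap:
  assumes "finite U"
  shows "integrable (measure_pmf T) (\<lambda>t. indicator G t * inverse p ^ card (U \<inter> A t))"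
proof (rule measure_pmf.integrable_const_bound[where B = "inverse p ^ card U"])
  have "inverse p ^ card (U \<inter> A t) \<le> inverse p ^ card U" for t
    using assms inverse_p_ge_1 by (intro power_increasing card_mono) auto
  then show "AE t in measure_pmf T. norm (indicator G t * inverse p ^ card (U \<inter> A t)) \<le> inverse p ^ card U"
    using p_pos by (intro AE_pmfI) (auto simp: indicator_def)
qed simp

text \<open>The power is 1 when \<open>A t\<close> misses \<open>U\<close> and at most
  \<open>inverse p ^ l\<close> otherwise; a union bound over the elements of \<open>U\<close>
  controls the second case.\<close>

lemma expectation_overlap:
  assumes "finite U"
  shows "measure_pmf.expectation T (\<lambda>t. indicator G t * inverse p ^ card (U \<inter> A t)) \<le>
    \<mu> + real (card U) * \<delta> * inverse p ^ l"
proof -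
  have ind: "integrable (measure_pmf T) (indicator H :: _ \<Rightarrow> real)" for H
    by (rule measure_pmf.integrable_const_bound[where B = 1]) auto
  have 1: "indicator G t * inverse p ^ card (U \<inter> A t) \<le>
    indicator G t + (\<Sum>i\<in>U. indicator {t \<in> G. i \<in> A t} t * inverse p ^ l)"
    if t: "t \<in> set_pmf T" for t
  proof (cases "U \<inter> A t = {}")
    case True
    then show ?thesis using p_pos by (simp add: sum_nonneg)
  next
    case False
    then obtain i where i: "i \<in> U" "i \<in> A t" by auto
    have "card (U \<inter> A t) \<le> card (A t)"
      using A_subset[OF t] by (intro card_mono) (auto intro: finite_subset)
    then have "inverse p ^ card (U \<inter> A t) \<le> inverse p ^ l"
      using card_A[OF t] inverse_p_ge_1 by (intro power_increasing) auto
    then have "indicator G t * inverse p ^ card (U \<inter> A t) \<le>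
      indicator {t \<in> G. i \<in> A t} t * inverse p ^ l"
      using i by (simp add: indicator_def)
    also have "\<dots> \<le> (\<Sum>i\<in>U. indicator {t \<in> G. i \<in> A t} t * inverse p ^ l)"
      using i assms p_pos by (intro member_le_sum) auto
    also have "\<dots> \<le> indicator G t + \<dots>" by simp
    finally show ?thesis .
  qed
  have "measure_pmf.expectation T (\<lambda>t. indicator G t * inverse p ^ card (U \<inter> A t)) \<le>
    measure_pmf.expectation T
      (\<lambda>t. indicator G t + (\<Sum>i\<in>U. indicator {t \<in> G. i \<in> A t} t * inverse p ^ l))"
    using 1 by (intro integral_mono_AE AE_pmfI integrable_overlap assms Bochner_Integration.integrable_add
        Bochner_Integration.integrable_sum integrable_mult_left ind) auto
  also have "\<dots> = \<mu> + (\<Sum>i\<in>U. measure_pmf.prob T {t \<in> G. i \<in> A t} * inverse p ^ l)"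
    by (simp add: \<mu>_def ind Bochner_Integration.integral_add Bochner_Integration.integral_sum)
  also have "\<dots> \<le> \<mu> + (\<Sum>i\<in>U. \<delta> * inverse p ^ l)"
    using degree p_pos by (intro add_left_mono sum_mono mult_right_mono) auto
  finally show ?thesis by (simp add: mult.assoc)
qed

text \<open>
  The factor \<open>hit_weight p U\<close> conditions on \<open>U \<subseteq> Q\<close>.  Splitting off one factor \<open>Y Q\<close> adds one more set
  \<open>A t\<close> to \<open>U\<close>, which costs \<open>\<mu>\<close> if the sets are disjoint and at most \<open>card U * \<delta> * p ^ (- l)\<close> otherwise.
\<close>

lemma moment_le:
  assumes "U \<subseteq> {..<n}"
  shows "measure_pmf.expectation (random_subset n p) (\<lambda>Q. Y Q ^ k * hit_weight p U Q) \<le>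
    (\<Prod>i<k. \<mu> + real (card U + l * i) * \<delta> * inverse p ^ l)"
  using assms
proof (induction k arbitrary: U)
  case 0
  then show ?case by (simp add: expectation_hit_weight p_pos p_le_1)
next
  case (Suc k)
  let ?R = "random_subset n p"
  \<comment> \<open>The shift to \<open>Suc i\<close> makes room for the at most \<open>l\<close>
    elements that \<open>A t\<close> adds to \<open>U\<close>. The factor for \<open>i = 0\<close>
    is supplied at the end by \<open>expectation_overlap\<close>.\<close>
  let ?B = "\<Prod>i<k. \<mu> + real (card U + l * Suc i) * \<delta> * inverse p ^ l"
  have finU: "finite U" using Suc.prems finite_subset by auto
  have Bpos: "0 \<le> ?B"
    using delta_nonneg p_pos by (intro prod_nonneg) (auto simp: \<mu>_def)
  have "measure_pmf.expectation ?R (\<lambda>Q. Y Q ^ Suc k * hit_weight p U Q) =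
    (\<Sum>Q\<in>Pow {..<n}. measure_pmf.expectation T
      (\<lambda>t. indicator G t * hit_weight p (A t) Q * (Y Q ^ k * hit_weight p U Q * pmf ?R Q)))"
    unfolding expectation_random_subset
    by (intro sum.cong) (auto simp: Y_def[symmetric])
  also have "\<dots> = measure_pmf.expectation T (\<lambda>t. \<Sum>Q\<in>Pow {..<n}.
      indicator G t * hit_weight p (A t) Q * (Y Q ^ k * hit_weight p U Q * pmf ?R Q))"
    by (rule Bochner_Integration.integral_sum[symmetric])
      (intro integrable_mult_left integrable_weights)
  also have "\<dots> \<le> measure_pmf.expectation T
    (\<lambda>t. indicator G t * inverse p ^ card (U \<inter> A t) * ?B)"
  proof (intro integral_mono_AE AE_pmfI)
    fix t assume t: "t \<in> set_pmf T"
    have finA: "finite (A t)" using A_subset[OF t] finite_subset by auto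
    have "(\<Sum>Q\<in>Pow {..<n}.
        indicator G t * hit_weight p (A t) Q * (Y Q ^ k * hit_weight p U Q * pmf ?R Q)) =
      indicator G t * inverse p ^ card (U \<inter> A t) *
        measure_pmf.expectation ?R (\<lambda>Q. Y Q ^ k * hit_weight p (U \<union> A t) Q)"
      unfolding expectation_random_subset sum_distrib_left
    proof (intro sum.cong refl)
      fix Q
      have "hit_weight p (A t) Q * hit_weight p U Q =
        inverse p ^ card (U \<inter> A t) * hit_weight p (U \<union> A t) Q"
        using hit_weight_mult[OF finU finA p_pos, of Q] by (simp add: mult.commute)
      then show "indicator G t * hit_weight p (A t) Q * (Y Q ^ k * hit_weight p U Q * pmf ?R Q) =
        indicator G t * inverse p ^ card (U \<inter> A t) *
          (Y Q ^ k * hit_weight p (U \<union> A t) Q * pmf ?R Q)"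
        by (simp add: mult_ac)
    qed
    also have "\<dots> \<le> indicator G t * inverse p ^ card (U \<inter> A t) *
      (\<Prod>i<k. \<mu> + real (card (U \<union> A t) + l * i) * \<delta> * inverse p ^ l)"
      using Suc.prems A_subset[OF t] p_pos by (intro mult_left_mono Suc.IH) auto
    also have "\<dots> \<le> indicator G t * inverse p ^ card (U \<inter> A t) * ?B"
    proof -
      have c: "card (U \<union> A t) \<le> card U + l"
        using card_Un_le[of U "A t"] card_A[OF t] by linarith
      have "real (card (U \<union> A t) + l * i) \<le> real (card U + l * Suc i)" for i
        using c by (simp only: of_nat_le_iff) simp
      then show ?thesis
        using delta_nonneg p_pos
        by (intro mult_left_mono prod_mono conjI add_left_mono mult_right_mono add_nonneg_nonneg)
          (auto simp: \<mu>_def)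
    qed
    finally show "(\<Sum>Q\<in>Pow {..<n}.
        indicator G t * hit_weight p (A t) Q * (Y Q ^ k * hit_weight p U Q * pmf ?R Q))
      \<le> indicator G t * inverse p ^ card (U \<inter> A t) * ?B" .
  qed (intro Bochner_Integration.integrable_sum integrable_mult_left integrable_weights
      integrable_overlap finU)+
  also have "\<dots> \<le> (\<mu> + real (card U) * \<delta> * inverse p ^ l) * ?B"
    using expectation_overlap[OF finU] Bpos by (simp add: mult_right_mono)
  also have "\<dots> = (\<Prod>i<Suc k. \<mu> + real (card U + l * i) * \<delta> * inverse p ^ l)"
    by (subst prod.lessThan_Suc_shift) simp
  finally show ?case .
qed

text \<open>The moment bound only gives one direction; the variance computation in
  \<open>lower_tail\<close> needs equality.\<close>

lemma expectation_Y: "measure_pmf.expectation (random_subset n p) Y = \<mu>"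
proof -
  let ?R = "random_subset n p"
  have "measure_pmf.expectation ?R Y = (\<Sum>Q\<in>Pow {..<n}. measure_pmf.expectation T
      (\<lambda>t. indicator G t * hit_weight p (A t) Q * pmf ?R Q))"
    unfolding expectation_random_subset
    by (intro sum.cong) (auto simp: Y_def[symmetric])
  also have "\<dots> = measure_pmf.expectation T (\<lambda>t. \<Sum>Q\<in>Pow {..<n}.
      indicator G t * hit_weight p (A t) Q * pmf ?R Q)"
    by (rule Bochner_Integration.integral_sum[symmetric])
      (intro integrable_mult_left integrable_weights)
  also have "\<dots> = measure_pmf.expectation T (\<lambda>t. indicator G t)"
  proof (intro integral_cong_AE AE_pmfI)
    fix t assume t: "t \<in> set_pmf T"
    have "(\<Sum>Q\<in>Pow {..<n}. indicator G t * hit_weight p (A t) Q * pmf ?R Q) =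
      indicator G t * measure_pmf.expectation ?R (hit_weight p (A t))"
      unfolding expectation_random_subset by (simp add: sum_distrib_left mult.assoc)
    then show "(\<Sum>Q\<in>Pow {..<n}. indicator G t * hit_weight p (A t) Q * pmf ?R Q) = indicator G t"
      using expectation_hit_weight[OF A_subset[OF t] p_pos p_le_1] by simp
  qed auto
  finally show ?thesis by (simp add: \<mu>_def)
qed

text \<open>Markov's inequality for the \<open>k\<close>-th power of \<open>Y\<close>, with every
  factor of the moment bound replaced by the largest. High moments are needed because this tail has
  to survive a union bound.\<close>

lemma upper_tail:
  assumes "0 < \<theta>"
  shows "measure_pmf.prob (random_subset n p) {Q. Y Q > \<theta>} \<le>
    ((\<mu> + real (l * k) * \<delta> * inverse p ^ l) / \<theta>) ^ k"
proof -
  let ?R = "random_subset n p"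
  have "measure_pmf.prob ?R {Q. Y Q > \<theta>} \<le>
    measure_pmf.prob ?R {Q \<in> space (measure_pmf ?R). Y Q ^ k \<ge> \<theta> ^ k}"
    using assms by (intro measure_pmf.finite_measure_mono) (auto intro: power_mono)
  also have "\<dots> \<le> measure_pmf.expectation ?R (\<lambda>Q. Y Q ^ k) / \<theta> ^ k"
    using assms Y_nonneg
    by (intro integral_Markov_inequality_measure[where A = "{}"]) (auto intro: integrable_random_subset)
  also have "measure_pmf.expectation ?R (\<lambda>Q. Y Q ^ k) \<le>
    (\<Prod>i<k. \<mu> + real (l * i) * \<delta> * inverse p ^ l)"
    using moment_le[of "{}" k] by (simp add: hit_weight_def)
  also have "\<dots> \<le> (\<Prod>i<k. \<mu> + real (l * k) * \<delta> * inverse p ^ l)"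
    using delta_nonneg p_pos
    by (intro prod_mono conjI add_left_mono mult_right_mono add_nonneg_nonneg)
      (auto simp: \<mu>_def intro: mult_left_mono)
  finally show ?thesis using assms by (simp add: power_divide divide_right_mono)
qed

text \<open>The second moment suffices, as this tail is only needed for one string. The first factor
  of the moment bound is exactly \<open>\<mu>\<close>, so subtracting the squared mean leaves just
  the correlation term.\<close>

lemma lower_tail:
  assumes "\<theta> < \<mu>"
  shows "measure_pmf.prob (random_subset n p) {Q. Y Q \<le> \<theta>} \<le>
    real l * \<delta> * inverse p ^ l / (\<mu> - \<theta>)\<^sup>2"
proof -
  let ?R = "random_subset n p"
  have mu1: "0 \<le> \<mu>" "\<mu> \<le> 1" by (auto simp: \<mu>_def)
  have sq: "measure_pmf.expectation ?R (\<lambda>Q. (Y Q)\<^sup>2) \<le> \<mu> * (\<mu> + real l * \<delta> * inverse p ^ l)"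
    using moment_le[of "{}" 2] by (simp add: hit_weight_def numeral_2_eq_2 lessThan_Suc mult.commute)
  have "measure_pmf.variance ?R Y = measure_pmf.expectation ?R (\<lambda>Q. (Y Q)\<^sup>2) - \<mu>\<^sup>2"
    by (subst measure_pmf.variance_eq) (auto intro: integrable_random_subset simp: expectation_Y)
  also have "\<dots> \<le> \<mu> * (real l * \<delta> * inverse p ^ l)"
    using sq by (simp add: power2_eq_square algebra_simps)
  also have "\<dots> \<le> 1 * (real l * \<delta> * inverse p ^ l)"
    using mu1 delta_nonneg p_pos by (intro mult_right_mono) auto
  finally have var: "measure_pmf.variance ?R Y \<le> real l * \<delta> * inverse p ^ l" by simp
  have "measure_pmf.prob ?R {Q. Y Q \<le> \<theta>} \<le>
    measure_pmf.prob ?R {Q \<in> space (measure_pmf ?R). \<mu> - \<theta> \<le> \<bar>Y Q - measure_pmf.expectation ?R Y\<bar>}"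
    by (intro measure_pmf.finite_measure_mono) (auto simp: expectation_Y)
  also have "\<dots> \<le> measure_pmf.variance ?R Y / (\<mu> - \<theta>)\<^sup>2"
    using assms by (intro measure_pmf.Chebyshev_inequality) (auto intro: integrable_random_subset)
  also have "\<dots> \<le> real l * \<delta> * inverse p ^ l / (\<mu> - \<theta>)\<^sup>2"
    using var by (intro divide_right_mono) auto
  finally show ?thesis .
qed

end

section \<open>Decision trees and the coordinates they can reach\<close>

lemma run_queries_cong:
  assumes "\<And>i. i \<in> set (queries t x) \<Longrightarrow> x i = y i"
  shows "queries t y = queries t x \<and> run t y = run t x"
  using assms by (induction t) auto

text \<open>The depth cutoff matters: the query bound says nothing about paths that no string
  follows, such as those on which one coordinate receives two different answers.\<close>

primrec reach :: "'a set \<Rightarrow> nat \<Rightarrow> 'a dtree \<Rightarrow> nat set" where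
  "reach \<Sigma> 0 t = {}"
| "reach \<Sigma> (Suc d) t =
    (case t of Output b \<Rightarrow> {} | Query i k \<Rightarrow> insert i (\<Union>a\<in>\<Sigma>. reach \<Sigma> d (k a)))"

lemma queries_subset_reach:
  assumes "x \<in> strings n \<Sigma>" "set (queries t x) \<subseteq> {..<n}" "length (queries t x) \<le> d"
  shows "set (queries t x) \<subseteq> reach \<Sigma> d t"
  using assms(2,3)
proof (induction t arbitrary: d)
  case (Query i k)
  then obtain e where e: "d = Suc e" by (cases d) auto
  have "x i \<in> \<Sigma>" using Query.prems assms(1) by (auto simp: strings_def)
  moreover have "set (queries (k (x i)) x) \<subseteq> reach \<Sigma> e (k (x i))"
    using Query.prems e by (intro Query.IH) auto
  ultimately show ?case using e by auto
qed auto

text \<open>Strictness carries the induction: the slack of 1 in each of the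
  \<open>card \<Sigma>\<close> subtrees adds up to at least 2, which pays for the root and keeps the
  bound strict.\<close>

lemma card_reach:
  assumes "finite \<Sigma>" "2 \<le> card \<Sigma>"
  shows "finite (reach \<Sigma> d t) \<and> card (reach \<Sigma> d t) < card \<Sigma> ^ d"
proof (induction d arbitrary: t)
  case (Suc d)
  show ?case
  proof (cases t)
    case (Query i k)
    let ?U = "\<Union>a\<in>\<Sigma>. reach \<Sigma> d (k a)"
    have fin: "finite ?U" using Suc assms by auto
    have "card ?U \<le> (\<Sum>a\<in>\<Sigma>. card (reach \<Sigma> d (k a)))"
      using assms by (intro card_UN_le)
    then have "card ?U + card \<Sigma> \<le> (\<Sum>a\<in>\<Sigma>. card (reach \<Sigma> d (k a)) + 1)"
      by (simp only: sum.distrib) simp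
    also have "\<dots> \<le> (\<Sum>a\<in>\<Sigma>. card \<Sigma> ^ d)"
      using Suc by (intro sum_mono) (simp add: Suc_le_eq)
    finally have "card ?U + card \<Sigma> \<le> card \<Sigma> * card \<Sigma> ^ d" by simp
    moreover have "card (insert i ?U) \<le> Suc (card ?U)" by (rule card_insert_le_m1) auto
    ultimately show ?thesis using fin assms Query by auto
  qed (use assms in auto)
qed auto

section \<open>Degree rings and the test applied to a sample\<close>

locale ring_decoder =
  fixes n L :: nat and \<Sigma> :: "'a set" and T :: "'a dtree pmf" and b :: bool
    and p :: real and \<delta> :: "nat \<Rightarrow> real"
  assumes finite_alphabet: "finite \<Sigma>" and card_alphabet: "2 \<le> card \<Sigma>"
    and queries: "\<And>t x. t \<in> set_pmf T \<Longrightarrow> x \<in> strings n \<Sigma> \<Longrightarrow>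
      length (queries t x) \<le> L \<and> set (queries t x) \<subseteq> {..<n}"
    and p_pos: "0 < p" and p_le_1: "p \<le> 1"
    and delta_pos: "\<And>j. 0 < \<delta> j" and delta_mono: "\<And>i j. i \<le> j \<Longrightarrow> \<delta> i \<le> \<delta> j"
    and L_pos: "0 < L"
begin

text \<open>Counting the coordinates reachable on any input makes the kernels independent of the
  unknown string; the price is the factor \<open>card \<Sigma> ^ L\<close> in
  \<open>card_K\<close>.\<close>

definition deg :: "nat \<Rightarrow> real" where
  "deg i = measure_pmf.prob T {t. i \<in> reach \<Sigma> L t}"

text \<open>These sets shrink as \<open>j\<close> grows. Ring \<open>j\<close> is
  \<open>K j - K (Suc j)\<close>, and its kernel is \<open>K (Suc j)\<close>.\<close>

definition K :: "nat \<Rightarrow> nat set" where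
  "K j = {i. i < n \<and> \<delta> j \<le> deg i}"

definition missing :: "(nat \<Rightarrow> 'a) \<Rightarrow> nat \<Rightarrow> 'a dtree set" where
  "missing y j = {t. run t y = (\<not> b) \<and> set (queries t y) \<inter> (K j - K (Suc j)) = {}}"

definition estimate :: "(nat \<Rightarrow> 'a) \<Rightarrow> nat \<Rightarrow> nat set \<Rightarrow> real" where
  "estimate y j Q = measure_pmf.expectation T
     (\<lambda>t. indicator (missing y j) t * hit_weight p (set (queries t y) - K (Suc j)) Q)"

lemma K_antimono: "i \<le> j \<Longrightarrow> K j \<subseteq> K i"
  using delta_mono unfolding K_def by (auto intro: order_trans)

lemma finite_K [simp]: "finite (K j)"
  by (simp add: K_def)

lemma queries_reach:
  "t \<in> set_pmf T \<Longrightarrow> x \<in> strings n \<Sigma> \<Longrightarrow> set (queries t x) \<subseteq> reach \<Sigma> L t"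
  using queries queries_subset_reach by blast

text \<open>Double counting: the degrees sum to at most the expected size of
  \<open>reach \<Sigma> L t\<close>.\<close>

lemma card_K: "real (card (K j)) \<le> real (card \<Sigma>) ^ L / \<delta> j"
proof -
  have "real (card (K j)) * \<delta> j = (\<Sum>i\<in>K j. \<delta> j)" by simp
  also have "\<dots> \<le> (\<Sum>i\<in>K j. deg i)" by (intro sum_mono) (auto simp: K_def)
  also have "\<dots> = measure_pmf.expectation T (\<lambda>t. \<Sum>i\<in>K j. indicator {t. i \<in> reach \<Sigma> L t} t)"
    by (subst Bochner_Integration.integral_sum)
      (auto simp: deg_def intro: measure_pmf.integrable_const_bound[where B = 1])
  also have "\<dots> \<le> measure_pmf.expectation T (\<lambda>t. real (card \<Sigma>) ^ L)"
  proof (intro integral_mono Bochner_Integration.integrable_sum)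
    fix t
    have "(\<Sum>i\<in>K j. indicator {t. i \<in> reach \<Sigma> L t} t) = real (card (K j \<inter> reach \<Sigma> L t))"
      by (simp add: indicator_def sum.If_cases)
    also have "\<dots> \<le> real (card (reach \<Sigma> L t))"
      using card_reach[OF finite_alphabet card_alphabet, of L t] by (intro of_nat_mono card_mono) auto
    also have "\<dots> \<le> real (card \<Sigma>) ^ L"
      using card_reach[OF finite_alphabet card_alphabet, of L t]
      by (metis less_imp_le_nat of_nat_le_iff of_nat_power)
    finally show "(\<Sum>i\<in>K j. indicator {t. i \<in> reach \<Sigma> L t} t) \<le> real (card \<Sigma>) ^ L" .
  qed (auto intro: measure_pmf.integrable_const_bound[where B = 1])
  finally show ?thesis using delta_pos[of j] by (simp add: pos_le_divide_eq)
qed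

text \<open>This is what the ring is for: a tree that avoids it and queries outside the kernel
  \<open>K (Suc j)\<close> must query outside \<open>K j\<close>, where degrees are below
  \<open>\<delta> j\<close>.\<close>

lemma sparse_family_missing:
  assumes y: "y \<in> strings n \<Sigma>"
  shows "sparse_family n L p (\<delta> j) T (missing y j) (\<lambda>t. set (queries t y) - K (Suc j))"
proof
  fix t assume t: "t \<in> set_pmf T"
  show "set (queries t y) - K (Suc j) \<subseteq> {..<n}" using queries[OF t y] by auto
  have "card (set (queries t y) - K (Suc j)) \<le> card (set (queries t y))"
    by (intro card_mono) auto
  also have "\<dots> \<le> length (queries t y)" by (rule card_length)
  also have "\<dots> \<le> L" using queries[OF t y] by auto
  finally show "card (set (queries t y) - K (Suc j)) \<le> L" .
next
  fix i
  let ?E = "{t \<in> missing y j. i \<in> set (queries t y) - K (Suc j)}"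
  show "measure_pmf.prob T ?E \<le> \<delta> j"
  \<comment> \<open>A null event satisfies the bound trivially. Otherwise one tree in it certifies
    \<open>i < n\<close> and \<open>i \<notin> K j\<close>.\<close>
  proof (cases "?E \<inter> set_pmf T = {}")
    case True
    then have "measure_pmf.prob T ?E = 0"
      by (subst measure_Int_set_pmf[symmetric]) (simp only: measure_empty)
    then show ?thesis using delta_pos[of j] by linarith
  next
    case False
    then obtain t where "t \<in> set_pmf T" "t \<in> missing y j" "i \<in> set (queries t y) - K (Suc j)" by auto
    then have "i < n" "i \<notin> K j" using queries[OF _ y] by (auto simp: missing_def)
    then have "deg i \<le> \<delta> j" by (simp add: K_def)
    moreover have "measure_pmf.prob T ?E \<le> deg i"
      unfolding deg_def using queries_reach[OF _ y]
      by (subst (1) measure_Int_set_pmf[symmetric], intro measure_pmf.finite_measure_mono) auto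
    ultimately show ?thesis by simp
  qed
qed (use p_pos p_le_1 in auto)

text \<open>The rings are disjoint, so a tree hits at most \<open>L\<close> of the
  \<open>12 * L\<close> rings. By averaging, some ring is hit with probability at most 1/12, and 2/3
  - 1/12 = 7/12.\<close>

lemma exists_missed_ring:
  assumes x: "x \<in> strings n \<Sigma>" and rej: "measure_pmf.prob T {t. run t x = (\<not> b)} \<ge> 2/3"
  shows "\<exists>j < 12 * L. measure_pmf.prob T (missing x j) \<ge> 7/12"
proof (rule ccontr)
  assume "\<not> ?thesis"
  then have less: "measure_pmf.prob T (missing x j) < 7/12" if "j < 12 * L" for j
    using that by auto
  define H where "H j = {t. set (queries t x) \<inter> (K j - K (Suc j)) \<noteq> {}}" for j
  have hit: "measure_pmf.prob T (H j) > 1/12" if "j < 12 * L" for j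
  proof -
    have "measure_pmf.prob T {t. run t x = (\<not> b)} \<le> measure_pmf.prob T (missing x j \<union> H j)"
      by (intro measure_pmf.finite_measure_mono) (auto simp: missing_def H_def)
    also have "\<dots> \<le> measure_pmf.prob T (missing x j) + measure_pmf.prob T (H j)"
      by (intro measure_Un_le) auto
    finally show ?thesis using rej less[OF that] by simp
  qed
  have "real L = (\<Sum>j<12 * L. 1/12)" by simp
  also have "\<dots> < (\<Sum>j<12 * L. measure_pmf.prob T (H j))"
    using hit L_pos by (intro sum_strict_mono) (auto simp: lessThan_empty_iff)
  also have "\<dots> = measure_pmf.expectation T (\<lambda>t. \<Sum>j<12 * L. indicator (H j) t)"
    by (subst Bochner_Integration.integral_sum)
      (auto intro: measure_pmf.integrable_const_bound[where B = 1])
  also have "\<dots> \<le> measure_pmf.expectation T (\<lambda>t. real L)"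
  proof (intro integral_mono_AE AE_pmfI Bochner_Integration.integrable_sum)
    fix t assume t: "t \<in> set_pmf T"
    let ?I = "\<lambda>j. set (queries t x) \<inter> (K j - K (Suc j))"
    have disj: "?I i \<inter> ?I j = {}" if "i \<noteq> j" for i j
      using K_antimono[of "Suc i" j] K_antimono[of "Suc j" i] that by (cases i j rule: linorder_cases) auto
    have "(\<Sum>j<12 * L. indicator (H j) t) \<le> (\<Sum>j<12 * L. real (card (?I j)))"
      by (intro sum_mono) (auto simp: H_def indicator_def Suc_le_eq card_gt_0_iff)
    also have "\<dots> = real (card (\<Union>j<12 * L. ?I j))"
      using disj by (subst card_UN_disjoint) auto
    also have "\<dots> \<le> real (card (set (queries t x)))"
      by (intro of_nat_mono card_mono) auto
    also have "\<dots> \<le> real L"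
      using queries[OF t x] card_length[of "queries t x"] by simp
    finally show "(\<Sum>j<12 * L. indicator (H j) t) \<le> real L" .
  qed (auto intro: measure_pmf.integrable_const_bound[where B = 1])
  finally show False by simp
qed

lemma prob_detect:
  assumes x: "x \<in> strings n \<Sigma>" and rej: "measure_pmf.prob T {t. run t x = (\<not> b)} \<ge> 2/3"
    and small: "\<And>j. j < 12 * L \<Longrightarrow> real L * \<delta> j * inverse p ^ L \<le> 1/576"
  shows "measure_pmf.prob (random_subset n p) {Q. \<exists>j < 12 * L. estimate x j Q > 1/2} \<ge> 3/4"
proof -
  let ?R = "random_subset n p"
  obtain j where j: "j < 12 * L" and prob: "measure_pmf.prob T (missing x j) \<ge> 7/12"
    using exists_missed_ring[OF x rej] by auto
  interpret sparse_family n L p "\<delta> j" T "missing x j" "\<lambda>t. set (queries t x) - K (Suc j)"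
    by (rule sparse_family_missing[OF x])
  have Y: "Y = estimate x j" by (simp add: Y_def estimate_def fun_eq_iff)
  have mu: "\<mu> \<ge> 7/12" using prob by (simp add: \<mu>_def)
  \<comment> \<open>The gap 7/12 - 1/2 = 1/12 enters Chebyshev squared, so the bound 1/576 yields
    failure probability 144/576 = 1/4.\<close>
  then have "(1/12)\<^sup>2 \<le> (\<mu> - 1/2)\<^sup>2" by (intro power_mono) auto
  then have sq: "1/144 \<le> (\<mu> - 1/2)\<^sup>2" by (simp add: power2_eq_square)
  have "measure_pmf.prob ?R {Q. estimate x j Q \<le> 1/2} \<le>
    real L * \<delta> j * inverse p ^ L / (\<mu> - 1/2)\<^sup>2"
    using lower_tail[of "1/2"] mu by (simp add: Y)
  also have "\<dots> \<le> (1/576) / (1/144)"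
    using small[OF j] sq by (intro frac_le) auto
  finally have "measure_pmf.prob ?R {Q. estimate x j Q \<le> 1/2} \<le> 1/4" by simp
  moreover have "measure_pmf.prob ?R {Q. estimate x j Q > 1/2} =
    1 - measure_pmf.prob ?R {Q. estimate x j Q \<le> 1/2}"
    using measure_pmf.prob_compl[of "{Q. estimate x j Q \<le> 1/2}" ?R]
    by (simp add: Compl_eq_Diff_UNIV[symmetric] Collect_neg_eq[symmetric] not_le)
  moreover have "measure_pmf.prob ?R {Q. estimate x j Q > 1/2} \<le>
    measure_pmf.prob ?R {Q. \<exists>j < 12 * L. estimate x j Q > 1/2}"
    using j by (intro measure_pmf.finite_measure_mono) auto
  ultimately show ?thesis by simp
qed

text \<open>A tree contributes only if its queries lie in the kernel or in \<open>Q\<close>. Where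
  two strings agree there, such a tree follows the same path on both; all other trees have weight 0
  on both.\<close>

lemma estimate_cong:
  assumes x: "x \<in> strings n \<Sigma>" and y: "y \<in> strings n \<Sigma>"
    and eq: "\<And>i. i \<in> K (Suc j) \<union> Q \<Longrightarrow> x i = y i"
  shows "estimate x j Q = estimate y j Q"
proof -
  have *: "indicator (missing x j) t * hit_weight p (set (queries t x) - K (Suc j)) Q =
    (indicator (missing y j) t * hit_weight p (set (queries t y) - K (Suc j)) Q :: real)" for t
  proof (cases "set (queries t x) \<subseteq> K (Suc j) \<union> Q \<or> set (queries t y) \<subseteq> K (Suc j) \<union> Q")
    case True
    then have "queries t y = queries t x \<and> run t y = run t x"
    proof
      assume "set (queries t x) \<subseteq> K (Suc j) \<union> Q"
      then show ?thesis using eq by (intro run_queries_cong) blast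
    next
      assume "set (queries t y) \<subseteq> K (Suc j) \<union> Q"
      then have "queries t x = queries t y \<and> run t x = run t y"
        using eq[symmetric] by (intro run_queries_cong) blast
      then show ?thesis by simp
    qed
    then show ?thesis by (simp add: missing_def indicator_def)
  next
    case False
    then have "\<not> set (queries t x) - K (Suc j) \<subseteq> Q" "\<not> set (queries t y) - K (Suc j) \<subseteq> Q" by auto
    then show ?thesis by (simp add: hit_weight_def)
  qed
  show ?thesis unfolding estimate_def * ..
qed

lemma prob_false_detect:
  fixes \<rho> :: real
  assumes x: "x \<in> strings n \<Sigma>"
    and acc: "\<And>w. w \<in> strings n \<Sigma> \<Longrightarrow> real (card {i. i < n \<and> x i \<noteq> w i}) \<le> \<rho> * real n \<Longrightarrow>
      measure_pmf.prob T {t. run t w = b} \<ge> 2/3"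
    and K0: "real (card \<Sigma>) ^ L / \<delta> 0 \<le> \<rho> * real n"
    and tail: "\<And>j. j < 12 * L \<Longrightarrow> \<exists>k. real k * (real L * \<delta> j * inverse p ^ L) \<le> 1/12 \<and>
      (\<forall>c::nat. real c \<le> real (card \<Sigma>) ^ L / \<delta> (Suc j) \<longrightarrow>
        real (12 * L) * real (card \<Sigma>) ^ c * (5/6) ^ k \<le> 1/4)"
  shows "measure_pmf.prob (random_subset n p)
    {Q. \<exists>y\<in>strings n \<Sigma>. (\<forall>i\<in>Q. y i = x i) \<and> (\<exists>j < 12 * L. estimate y j Q > 1/2)} \<le> 1/4"
proof -
  let ?R = "random_subset n p"
  define W where "W j = K (Suc j) \<rightarrow>\<^sub>E \<Sigma>" for j
  \<comment> \<open>A string consistent with the sample may be replaced by \<open>x\<close>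
    overwritten on the kernel. These patched strings are fixed before \<open>Q\<close> is drawn, so
    a union bound over them is legitimate; they differ from \<open>x\<close> only inside
    \<open>K 0\<close>, so robustness applies to them.\<close>
  define patch where "patch j w = (\<lambda>i. if i \<in> K (Suc j) then w i else x i)" for j and w :: "nat \<Rightarrow> 'a"
  have patch: "patch j w \<in> strings n \<Sigma>" if "w \<in> W j" for j w
    using that x by (auto simp: patch_def W_def strings_def PiE_def Pi_def extensional_def K_def)
  have finW: "finite (W j)" for j
    unfolding W_def using finite_alphabet by (intro finite_PiE) auto
  have cardW: "card (W j) = card \<Sigma> ^ card (K (Suc j))" for j
    by (simp add: W_def card_PiE)
  have single: "measure_pmf.prob ?R {Q. estimate (patch j w) j Q > 1/2} \<le> (5/6) ^ k"
    if w: "w \<in> W j" and k: "real k * (real L * \<delta> j * inverse p ^ L) \<le> 1/12" for j w k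
  proof -
    interpret sparse_family n L p "\<delta> j" T "missing (patch j w) j"
      "\<lambda>t. set (queries t (patch j w)) - K (Suc j)"
      by (rule sparse_family_missing[OF patch[OF w]])
    have Y: "Y = estimate (patch j w) j" by (simp add: Y_def estimate_def fun_eq_iff)
    have "card {i. i < n \<and> x i \<noteq> patch j w i} \<le> card (K 0)"
      using K_antimono[of 0 "Suc j"] by (intro card_mono) (auto simp: patch_def)
    then have "real (card {i. i < n \<and> x i \<noteq> patch j w i}) \<le> \<rho> * real n"
      using card_K[of 0] K0 by linarith
    then have acc': "measure_pmf.prob T {t. run t (patch j w) = b} \<ge> 2/3"
      using acc patch[OF w] by blast
    have "\<mu> \<le> measure_pmf.prob T (- {t. run t (patch j w) = b})"
      unfolding \<mu>_def by (intro measure_pmf.finite_measure_mono) (auto simp: missing_def)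
    also have "\<dots> \<le> 1/3"
      using measure_pmf.prob_compl[of "{t. run t (patch j w) = b}" T] acc'
      by (simp add: Compl_eq_Diff_UNIV)
    finally have mu: "\<mu> \<le> 1/3" .
    have mu0: "0 \<le> \<mu>" by (simp add: \<mu>_def)
    have "measure_pmf.prob ?R {Q. estimate (patch j w) j Q > 1/2} \<le>
      ((\<mu> + real (L * k) * \<delta> j * inverse p ^ L) / (1/2)) ^ k"
      using upper_tail[of "1/2" k] by (simp add: Y)
    \<comment> \<open>The base is at most (1/3 + 1/12) / (1/2) = 5/6.\<close>
    also have "\<dots> \<le> (5/6) ^ k"
      using mu mu0 k delta_nonneg p_pos by (intro power_mono) (auto simp: mult_ac)
    finally show ?thesis .
  qed
  have ring: "measure_pmf.prob ?R (\<Union>w\<in>W j. {Q. estimate (patch j w) j Q > 1/2}) \<le> 1 / (4 * real (12 * L))"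
    if j: "j < 12 * L" for j
  proof -
    obtain k where k: "real k * (real L * \<delta> j * inverse p ^ L) \<le> 1/12"
      and c: "\<And>c. real c \<le> real (card \<Sigma>) ^ L / \<delta> (Suc j) \<Longrightarrow>
        real (12 * L) * real (card \<Sigma>) ^ c * (5/6) ^ k \<le> 1/4"
      using tail[OF j] by blast
    have "measure_pmf.prob ?R (\<Union>w\<in>W j. {Q. estimate (patch j w) j Q > 1/2}) \<le>
      (\<Sum>w\<in>W j. measure_pmf.prob ?R {Q. estimate (patch j w) j Q > 1/2})"
      using finW by (intro measure_pmf.finite_measure_subadditive_finite) auto
    also have "\<dots> \<le> (\<Sum>w\<in>W j. (5/6) ^ k)" using single k by (intro sum_mono) auto
    also have "\<dots> = real (card \<Sigma>) ^ card (K (Suc j)) * (5/6) ^ k" by (simp add: cardW)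
    also have "\<dots> \<le> 1 / (4 * real (12 * L))"
      using c[OF card_K] L_pos by (simp add: field_simps)
    finally show ?thesis .
  qed
  have "measure_pmf.prob ?R
      {Q. \<exists>y\<in>strings n \<Sigma>. (\<forall>i\<in>Q. y i = x i) \<and> (\<exists>j < 12 * L. estimate y j Q > 1/2)} \<le>
    measure_pmf.prob ?R (\<Union>j<12 * L. \<Union>w\<in>W j. {Q. estimate (patch j w) j Q > 1/2})"
  proof (intro measure_pmf.finite_measure_mono subsetI)
    fix Q assume "Q \<in> {Q. \<exists>y\<in>strings n \<Sigma>. (\<forall>i\<in>Q. y i = x i) \<and> (\<exists>j < 12 * L. estimate y j Q > 1/2)}"
    then obtain y j where y: "y \<in> strings n \<Sigma>" "\<forall>i\<in>Q. y i = x i" "j < 12 * L" "estimate y j Q > 1/2"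
      by auto
    define w where "w = restrict y (K (Suc j))"
    have w: "w \<in> W j" using y(1) by (auto simp: w_def W_def strings_def K_def)
    have "estimate y j Q = estimate (patch j w) j Q"
      using y by (intro estimate_cong patch w) (auto simp: patch_def w_def)
    then show "Q \<in> (\<Union>j<12 * L. \<Union>w\<in>W j. {Q. estimate (patch j w) j Q > 1/2})"
      using y w by auto
  qed simp
  also have "\<dots> \<le> (\<Sum>j<12 * L. measure_pmf.prob ?R (\<Union>w\<in>W j. {Q. estimate (patch j w) j Q > 1/2}))"
    by (intro measure_pmf.finite_measure_subadditive_finite) auto
  also have "\<dots> \<le> (\<Sum>j<12 * L. 1 / (4 * real (12 * L)))" using ring by (intro sum_mono) auto
  also have "\<dots> = 1/4" using L_pos by simp
  finally show ?thesis .
qed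

end

section \<open>Choice of the numerical parameters\<close>

lemma half_le_ln:
  fixes m :: nat
  assumes "2 \<le> m"
  shows "1/2 \<le> ln (real m)"
proof -
  have "1/2 \<le> ln (2 :: real)"
    using ln_le_minus_one[of "1/2 :: real"] by (simp add: ln_div)
  also have "\<dots> \<le> ln (real m)" using assms by simp
  finally show ?thesis .
qed

text \<open>
  \<open>R\<close> is the ratio of consecutive degree thresholds.  The exponent \<open>1/(2q\<^sup>2)\<close> with \<open>q = 3L\<close> suffices
  because \<open>R ^ (12 L) * p ^ (- L)\<close> contains \<open>p\<close> to the power \<open>- (12 L\<^sup>2 + L) \<ge> - 18 L\<^sup>2\<close>.
\<close>

lemma geometric_radii_bounds:
  fixes n L S :: nat and \<rho> c p R :: real
  assumes L: "2 \<le> L" and S: "2 \<le> S" and n: "0 < n" and \<rho>: "0 < \<rho>"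
    and c: "13824 \<le> c" "13824 / \<rho> \<le> c"
    and p_def: "p = c * real S ^ (3 * L) * (2 * ln (real S)) * real n powr (- 1 / (18 * (real L)\<^sup>2))"
    and p_le_1: "p \<le> 1"
    and R_def: "R = 288 * real L * inverse p ^ L * real S ^ L * ln (real S)"
  shows "0 < p" "1 \<le> R"
    "real L * (real S ^ L / (\<rho> * real n) * R ^ (12 * L)) * inverse p ^ L \<le> 1 / (13824 * real L)"
proof -
  define a where "a = c * real S ^ (3 * L) * (2 * ln (real S))"
  define N where "N = real n powr (1 / (18 * (real L)\<^sup>2))"
  let ?e = "L * (12 * L) + L"
  have lnS: "1 \<le> 2 * ln (real S)" using half_le_ln[OF S] by simp
  have SL: "1 \<le> real S ^ L" using S by (intro one_le_power) auto
  \<comment> \<open>Every factor \<open>L\<close> can thus be absorbed into a factor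
    \<open>S ^ L\<close>, which is why \<open>p\<close> carries the exponent
    \<open>3 * L\<close>.\<close>
  have "L < 2 ^ L" by (rule less_exp)
  also have "\<dots> \<le> S ^ L" using S by (intro power_mono) auto
  finally have LS: "real L \<le> real S ^ L" by (metis less_imp_le of_nat_le_iff of_nat_power)
  have S3: "real S ^ (3 * L) = real S ^ L * real S ^ L * real S ^ L"
    by (simp add: eval_nat_numeral power_add)
  have cpos: "0 < c" using c by simp
  have a_step: "144 * real L * real S ^ L * (2 * ln (real S)) \<le> a"
  proof -
    have "144 * real L * real S ^ L \<le> c * real S ^ L * (real S ^ L * real S ^ L)"
      using c LS SL mult_mono[of 1 "real S ^ L" "real S ^ L" "real S ^ L"] by (intro mult_mono) auto
    then show ?thesis unfolding a_def S3 using lnS by (intro mult_right_mono) (auto simp: mult_ac)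
  qed
  have a_init: "13824 * real L * real L * real S ^ L / \<rho> \<le> a"
  proof -
    have "(13824 / \<rho>) * (real L * real L) * real S ^ L \<le> c * (real S ^ L * real S ^ L) * real S ^ L"
      using c LS cpos by (intro mult_mono) auto
    also have "\<dots> = c * real S ^ (3 * L) * 1" by (simp add: S3)
    also have "\<dots> \<le> a" unfolding a_def using lnS cpos by (intro mult_left_mono) auto
    finally show ?thesis by (simp add: mult_ac)
  qed
  have a1: "1 \<le> a"
  proof -
    have "1 * 1 * 1 \<le> a" unfolding a_def using c S lnS by (intro mult_mono one_le_power) auto
    then show ?thesis by simp
  qed
  have p_eq: "p = a * inverse N"
    by (simp add: p_def a_def N_def powr_minus)
  have N: "0 < N" using n by (simp add: N_def)
  show p: "0 < p" using a1 N by (simp add: p_eq)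
  have ip: "inverse p = N / a" using N a1 by (simp add: p_eq field_simps)
  have ip1: "1 \<le> inverse p ^ L" using p p_le_1 by (intro one_le_power) (simp add: one_le_inverse)
  have R0: "R = (144 * real L * real S ^ L * (2 * ln (real S))) * inverse p ^ L" by (simp add: R_def)
  have "1 * 1 * 1 * 1 \<le> (144 * real L * real S ^ L * (2 * ln (real S)))"
    using L SL lnS by (intro mult_mono) auto
  then have "1 * 1 \<le> R" unfolding R0 using ip1 by (intro mult_mono) auto
  then show R1: "1 \<le> R" by simp
  have RL: "R \<le> a * inverse p ^ L" unfolding R0 using a_step p by (intro mult_right_mono) auto
  have "R ^ (12 * L) * inverse p ^ L \<le> (a * inverse p ^ L) ^ (12 * L) * inverse p ^ L"
    using RL R1 p by (intro mult_right_mono power_mono) auto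
  also have "\<dots> = a ^ (12 * L) * inverse p ^ ?e"
    by (simp only: power_mult_distrib power_mult power_add mult.assoc)
  finally have RN: "R ^ (12 * L) * inverse p ^ L \<le> a ^ (12 * L) * inverse p ^ ?e" .
  have "N ^ ?e = real n powr (real ?e * (1 / (18 * (real L)\<^sup>2)))"
    using n by (simp add: N_def powr_realpow[symmetric] powr_powr mult.commute)
  also have "\<dots> \<le> real n powr 1"
  proof (intro powr_mono)
    have "2 * real L \<le> real L * real L" using L by (intro mult_right_mono) auto
    then show "real ?e * (1 / (18 * (real L)\<^sup>2)) \<le> 1"
      using L by (simp add: field_simps power2_eq_square)
  qed (use n in auto)
  finally have Nn: "N ^ ?e \<le> real n" using n by simp
  \<comment> \<open>The factor \<open>inverse p ^ ?e\<close> divides by \<open>a ^ ?e\<close>. This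
    pays for one \<open>a\<close> from the initial threshold and \<open>12 * L\<close> from the
    ratios.\<close>
  have "a * a ^ (12 * L) \<le> a ^ ?e"
  proof -
    have "1 + 12 * L \<le> ?e" using L mult_le_mono[of 1 L "12 * L" "12 * L"] by linarith
    then show ?thesis using power_increasing[OF _ a1] by (metis power_Suc plus_1_eq_Suc)
  qed
  have "13824 * real L * (real L * (real S ^ L / (\<rho> * real n) * R ^ (12 * L)) * inverse p ^ L) =
    (13824 * real L * real L * real S ^ L / \<rho>) / real n * (R ^ (12 * L) * inverse p ^ L)"
    by simp
  also have "\<dots> \<le> a / real n * (a ^ (12 * L) * inverse p ^ ?e)"
    using R1 p a1 by (intro mult_mono[OF divide_right_mono[OF a_init] RN]) auto
  also have "\<dots> = (a * a ^ (12 * L) / a ^ ?e) * (N ^ ?e / real n)"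
    by (simp add: ip power_divide mult_ac)
  also have "\<dots> \<le> 1 * 1"
    using \<open>a * a ^ (12 * L) \<le> a ^ ?e\<close> a1 Nn n N by (intro mult_mono) auto
  finally have "13824 * real L * (real L * (real S ^ L / (\<rho> * real n) * R ^ (12 * L)) * inverse p ^ L) \<le> 1"
    by simp
  then show "real L * (real S ^ L / (\<rho> * real n) * R ^ (12 * L)) * inverse p ^ L \<le> 1 / (13824 * real L)"
    using L by (simp add: field_simps)
qed

text \<open>Since \<open>k\<close> is about \<open>1 / (12 * \<epsilon>)\<close>, the power of 5/6
  is at most \<open>exp (- 1 / (144 * \<epsilon>))\<close>. Half of this exponent pays for the
  \<open>S ^ c\<close> kernel assignments, the other half for \<open>48 * L\<close>; the latter
  requires 48 * 288 = 13824.\<close>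

lemma exponential_tail_bound:
  fixes L S :: nat and \<epsilon> :: real
  assumes L: "2 \<le> L" and S: "2 \<le> S" and \<epsilon>: "0 < \<epsilon>" "\<epsilon> \<le> 1 / (13824 * real L)"
  shows "\<exists>k. real k * \<epsilon> \<le> 1/12 \<and>
    (\<forall>c::nat. real c * ln (real S) \<le> 1 / (288 * \<epsilon>) \<longrightarrow>
      real (12 * L) * real S ^ c * (5/6) ^ k \<le> 1/4)"
proof -
  define k where "k = nat \<lfloor>1 / (12 * \<epsilon>)\<rfloor>"
  have inv: "13824 * real L \<le> 1 / \<epsilon>" using \<epsilon> L by (simp add: field_simps)
  have "real k \<le> 1 / (12 * \<epsilon>)" using \<epsilon> by (simp add: k_def)
  then have k1: "real k * \<epsilon> \<le> 1/12" using \<epsilon> by (simp add: field_simps)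
  have "1 / (12 * \<epsilon>) - 1 \<le> real k" using \<epsilon> unfolding k_def by linarith
  \<comment> \<open>Rounding down loses at most 1, which is less than half of
    \<open>1 / (12 * \<epsilon>)\<close>.\<close>
  then have k2: "1 / \<epsilon> / 24 \<le> real k" using inv L by simp
  show ?thesis
  proof (intro exI[of _ k] conjI allI impI k1)
    fix c :: nat assume c: "real c * ln (real S) \<le> 1 / (288 * \<epsilon>)"
    have "(5/6::real) ^ k \<le> exp (- 1/6) ^ k"
      using exp_ge_add_one_self[of "- 1/6 :: real"] by (intro power_mono) auto
    also have "\<dots> = exp (- real k / 6)" by (simp flip: exp_of_nat_mult)
    also have "\<dots> \<le> exp (- (1 / \<epsilon> / 144))" using k2 by simp
    finally have A: "(5/6::real) ^ k \<le> exp (- (1 / \<epsilon> / 144))" .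
    have B: "real S ^ c \<le> exp (1 / \<epsilon> / 288)"
    proof -
      have "real S ^ c = exp (real c * ln (real S))" using S by (simp add: exp_of_nat_mult)
      then show ?thesis using c by simp
    qed
    have C: "4 * real (12 * L) \<le> exp (1 / \<epsilon> / 288)"
    proof -
      have "4 * real (12 * L) \<le> exp (4 * real (12 * L))"
        using exp_ge_add_one_self[of "4 * real (12 * L)"] by linarith
      also have "\<dots> \<le> exp (1 / \<epsilon> / 288)" using inv by simp
      finally show ?thesis .
    qed
    have "4 * real (12 * L) * real S ^ c * (5/6) ^ k \<le>
      exp (1 / \<epsilon> / 288) * exp (1 / \<epsilon> / 288) * exp (- (1 / \<epsilon> / 144))"
      by (intro mult_mono A B C) auto
    also have "\<dots> = 1" by (simp flip: exp_add)
    finally show "real (12 * L) * real S ^ c * (5/6) ^ k \<le> 1/4" by simp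
  qed
qed

section \<open>From the decoder to a sample-based algorithm\<close>

lemma random_subset_1: "random_subset n 1 = return_pmf {..<n}"
proof -
  have "bernoulli_pmf 1 = return_pmf True"
  proof (rule pmf_eqI)
    fix a show "pmf (bernoulli_pmf 1) a = pmf (return_pmf True) a" by (cases a) auto
  qed
  then show ?thesis
    by (simp add: random_subset_def Pi_pmf_return_pmf) auto
qed

lemma random_subset_0: "random_subset n 0 = return_pmf {}"
proof -
  have "bernoulli_pmf 0 = return_pmf False"
  proof (rule pmf_eqI)
    fix a show "pmf (bernoulli_pmf 0) a = pmf (return_pmf False) a" by (cases a) auto
  qed
  then show ?thesis
    by (simp add: random_subset_def Pi_pmf_return_pmf)
qed

text \<open>Covers the extreme probabilities 0 and 1, where the sample is deterministic and
  determines the string, so \<open>f\<close> can be evaluated directly.\<close>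

lemma sample_based_algorithm_reconstruct:
  assumes "partial_fun n \<Sigma> Z f" and "0 \<le> p" "p \<le> 1" and "random_subset n p = return_pmf Q"
    and "real (card Q) \<le> s" and "\<And>x. x \<in> strings n \<Sigma> \<Longrightarrow> g ((Some \<circ> x) |` Q) = x"
  shows "\<exists>N. sample_based_algorithm n f s (1/3) p N"
proof (intro exI)
  show "sample_based_algorithm n f s (1/3) p (\<lambda>z m. return_pmf (the (f (z, g m))))"
    unfolding sample_based_algorithm_def
  proof (intro conjI allI impI)
    fix z x b assume f: "f (z, x) = Some b"
    then have "x \<in> strings n \<Sigma>" using assms(1) by (auto simp: partial_fun_def)
    then show "1 - 1/3 \<le> measure_pmf.prob (sample_run n p s (\<lambda>z m. return_pmf (the (f (z, g m)))) z x) {Some b}"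
      using assms f by (simp add: sample_run_def bind_return_pmf)
  qed (use assms in auto)
qed

lemma prob_sample_run:
  assumes rule: "\<And>Q. N z ((Some \<circ> x) |` Q) = return_pmf (g Q)"
  shows "measure_pmf.prob (sample_run n p s N z x) {Some b} \<ge>
    measure_pmf.prob (random_subset n p) {Q. g Q = b} -
    measure_pmf.prob (random_subset n p) {Q. real (card Q) > s}"
proof -
  let ?R = "random_subset n p"
  have "sample_run n p s N z x = map_pmf (\<lambda>Q. if real (card Q) \<le> s then Some (g Q) else None) ?R"
    unfolding sample_run_def map_pmf_def by (intro bind_pmf_cong) (auto simp: rule bind_return_pmf)
  then have "measure_pmf.prob (sample_run n p s N z x) {Some b} =
    measure_pmf.prob ?R ({Q. g Q = b} - {Q. real (card Q) > s})"
    by (auto intro!: arg_cong[where f = "measure_pmf.prob ?R"] split: if_splits)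
  moreover have "measure_pmf.prob ?R {Q. g Q = b} \<le>
    measure_pmf.prob ?R ({Q. g Q = b} - {Q. real (card Q) > s}) +
    measure_pmf.prob ?R {Q. real (card Q) > s}"
    by (rule order_trans[OF measure_pmf.finite_measure_mono measure_Un_le]) auto
  ultimately show ?thesis by simp
qed

lemma sample_based_algorithm_of_robust:
  fixes n l L :: nat and \<Sigma> :: "'a set" and \<rho> c p :: real
  assumes finite: "finite \<Sigma>" and card: "2 \<le> card \<Sigma>" and n: "0 < n" and L: "2 \<le> L" "l \<le> L"
    and pf: "partial_fun n \<Sigma> Z f" and alg: "local_algorithm n \<Sigma> Z f l (1/3) M"
    and rob: "\<And>z x w. f (z, x) = Some b \<Longrightarrow> w \<in> strings n \<Sigma> \<Longrightarrow>
      real (card {i. i < n \<and> x i \<noteq> w i}) \<le> \<rho> * real n \<Longrightarrow> output_prob M z w b \<ge> 2/3"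
    and \<rho>: "0 < \<rho>" and c: "13824 \<le> c" "13824 / \<rho> \<le> c"
    and p_def: "p = c * real (card \<Sigma>) ^ (3 * L) * (2 * ln (real (card \<Sigma>))) *
      real n powr (- 1 / (18 * (real L)\<^sup>2))"
    and p_le_1: "p \<le> 1"
  shows "\<exists>N. sample_based_algorithm n f (12 * real n * p) (1/3) p N"
proof -
  define R where "R = 288 * real L * inverse p ^ L * real (card \<Sigma>) ^ L * ln (real (card \<Sigma>))"
  note bounds = geometric_radii_bounds[OF L(1) card n \<rho> c p_def p_le_1 R_def]
  \<comment> \<open>The initial threshold is chosen so that \<open>card_K\<close> gives
    \<open>K 0\<close> at most \<open>\<rho> * n\<close> elements.\<close>
  define \<delta> where "\<delta> j = real (card \<Sigma>) ^ L / (\<rho> * real n) * R ^ j" for j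
  have cS: "0 < real (card \<Sigma>)" using card by simp
  have lnS: "0 < ln (real (card \<Sigma>))" using card by simp
  have \<delta>_pos: "0 < \<delta> j" for j
    using bounds(2) n \<rho> cS by (simp add: \<delta>_def)
  have \<delta>_mono: "\<delta> i \<le> \<delta> j" if "i \<le> j" for i j
    unfolding \<delta>_def using that bounds(2) n \<rho> cS by (intro mult_left_mono power_increasing) auto
  have \<epsilon>_le: "real L * \<delta> j * inverse p ^ L \<le> 1 / (13824 * real L)" if "j < 12 * L" for j
  proof -
    have "real L * \<delta> j * inverse p ^ L \<le> real L * \<delta> (12 * L) * inverse p ^ L"
      using \<delta>_mono[of j "12 * L"] that bounds(1) by (intro mult_right_mono mult_left_mono) auto
    then show ?thesis using bounds(3) by (simp add: \<delta>_def)
  qed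
  have \<epsilon>_small: "real L * \<delta> j * inverse p ^ L \<le> 1/576" if "j < 12 * L" for j
  proof -
    have "1 / (13824 * real L) \<le> 1/576" using L by (simp add: field_simps)
    then show ?thesis using \<epsilon>_le[OF that] by linarith
  qed
  have tail: "\<exists>k. real k * (real L * \<delta> j * inverse p ^ L) \<le> 1/12 \<and>
      (\<forall>c::nat. real c \<le> real (card \<Sigma>) ^ L / \<delta> (Suc j) \<longrightarrow>
        real (12 * L) * real (card \<Sigma>) ^ c * (5/6) ^ k \<le> 1/4)" if j: "j < 12 * L" for j
  proof -
    let ?\<epsilon> = "real L * \<delta> j * inverse p ^ L"
    have "0 < ?\<epsilon>" using L \<delta>_pos bounds(1) by simp
    then obtain k where k: "real k * ?\<epsilon> \<le> 1/12"
      "\<And>c::nat. real c * ln (real (card \<Sigma>)) \<le> 1 / (288 * ?\<epsilon>) \<Longrightarrow>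
        real (12 * L) * real (card \<Sigma>) ^ c * (5/6) ^ k \<le> 1/4"
      using exponential_tail_bound[OF L(1) card _ \<epsilon>_le[OF j]] by blast
    \<comment> \<open>The ratio \<open>R\<close> was chosen for this identity: the logarithm of the
      number of kernel assignments then fits the tail bound of the next lower threshold.\<close>
    have "real (card \<Sigma>) ^ L / \<delta> (Suc j) * ln (real (card \<Sigma>)) = 1 / (288 * ?\<epsilon>)"
    proof -
      have "\<delta> (Suc j) = R * \<delta> j" by (simp add: \<delta>_def)
      then show ?thesis unfolding R_def
        using \<delta>_pos[of j] \<delta>_pos[of "Suc j"] bounds(1) lnS cS L by (simp add: field_simps)
    qed
    then have "real c * ln (real (card \<Sigma>)) \<le> 1 / (288 * ?\<epsilon>)"
      if "real c \<le> real (card \<Sigma>) ^ L / \<delta> (Suc j)" for c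
      using mult_right_mono[OF that, of "ln (real (card \<Sigma>))"] lnS by simp
    then show ?thesis using k by blast
  qed
  have K0: "real (card \<Sigma>) ^ L / \<delta> 0 \<le> \<rho> * real n"
    using cS \<rho> n by (simp add: \<delta>_def)
  have decoder: "ring_decoder n L \<Sigma> (M z) p \<delta>" if z: "z \<in> Z" for z
  proof
    fix t x assume "t \<in> set_pmf (M z)" "x \<in> strings n \<Sigma>"
    then show "length (queries t x) \<le> L \<and> set (queries t x) \<subseteq> {..<n}"
      using alg z L unfolding local_algorithm_def by (meson order_trans)
  qed (use finite card bounds(1) p_le_1 \<delta>_pos \<delta>_mono L in auto)
  \<comment> \<open>Acceptance is evidence for \<open>\<not> b\<close>; without it the rule answers
    \<open>b\<close>.\<close>
  define accept where "accept z m \<longleftrightarrow> (\<exists>y\<in>strings n \<Sigma>. (\<forall>i\<in>dom m. Some (y i) = m i) \<and>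
    (\<exists>j<12 * L. ring_decoder.estimate n L \<Sigma> (M z) b p \<delta> y j (dom m) > 1/2))" for z m
  define N where "N z m = return_pmf (if accept z m then \<not> b else b)" for z m
  have "sample_based_algorithm n f (12 * real n * p) (1/3) p N"
    unfolding sample_based_algorithm_def
  proof (intro conjI allI impI)
    fix z x b' assume f: "f (z, x) = Some b'"
    then have z: "z \<in> Z" and x: "x \<in> strings n \<Sigma>" using pf by (auto simp: partial_fun_def)
    interpret ring_decoder n L \<Sigma> "M z" b p \<delta> by (rule decoder[OF z])
    let ?R = "random_subset n p"
    let ?D = "{Q. \<exists>y\<in>strings n \<Sigma>. (\<forall>i\<in>Q. y i = x i) \<and> (\<exists>j<12 * L. estimate y j Q > 1/2)}"
    have acc: "accept z ((Some \<circ> x) |` Q) \<longleftrightarrow> Q \<in> ?D" for Q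
    proof -
      have "dom ((Some \<circ> x) |` Q) = Q" by (auto simp: restrict_map_def split: if_splits)
      then show ?thesis by (auto simp: accept_def)
    qed
    \<comment> \<open>The test is right with probability at least 3/4, and 3/4 - 1/12 = 2/3.\<close>
    have cap: "measure_pmf.prob ?R {Q. real (card Q) > 12 * real n * p} \<le> 1/12"
      using prob_card_random_subset_gt[of p "12 * real n * p" n] n p_pos p_le_1 by simp
    have out: "measure_pmf.prob (M z) {t. run t x = b'} \<ge> 2/3"
      using alg f unfolding local_algorithm_def output_prob_def by fastforce
    have "measure_pmf.prob ?R {Q. (if Q \<in> ?D then \<not> b else b) = b'} \<ge> 3/4"
    proof (cases "b' = b")
      case True
      have "measure_pmf.prob ?R ?D \<le> 1/4"
        by (rule prob_false_detect[OF x _ K0 tail])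
          (use rob f True in \<open>auto simp: output_prob_def\<close>)
      moreover have "{Q. (if Q \<in> ?D then \<not> b else b) = b'} = - ?D" using True by auto
      ultimately show ?thesis
        using measure_pmf.prob_compl[of ?D ?R] by (simp add: Compl_eq_Diff_UNIV)
    next
      case False
      then have b': "b' = (\<not> b)" by auto
      have "3/4 \<le> measure_pmf.prob ?R {Q. \<exists>j<12 * L. estimate x j Q > 1/2}"
        using out b' \<epsilon>_small by (intro prob_detect[OF x]) auto
      also have "\<dots> \<le> measure_pmf.prob ?R {Q. (if Q \<in> ?D then \<not> b else b) = b'}"
        using x b' by (intro measure_pmf.finite_measure_mono) auto
      finally show ?thesis .
    qed
    moreover have "measure_pmf.prob (sample_run n p (12 * real n * p) N z x) {Some b'} \<ge>
      measure_pmf.prob ?R {Q. (if Q \<in> ?D then \<not> b else b) = b'} -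
      measure_pmf.prob ?R {Q. real (card Q) > 12 * real n * p}"
      by (rule prob_sample_run) (simp add: N_def acc)
    ultimately show "1 - 1/3 \<le> measure_pmf.prob (sample_run n p (12 * real n * p) N z x) {Some b'}"
      using cap by simp
  qed (use bounds(1) p_le_1 in auto)
  then show ?thesis by blast
qed

theorem theorem6p1:
  fixes \<rho> :: real
  assumes "\<rho> > 0"
  shows "\<exists>C D :: real. \<forall>(n :: nat) (\<Sigma> :: 'a set) (Z :: 'z set) f (l :: nat) M \<rho>\<^sub>0 \<rho>\<^sub>1.
    finite \<Sigma> \<longrightarrow>
    partial_fun n \<Sigma> Z f \<longrightarrow>
    local_algorithm n \<Sigma> Z f l (1/3) M \<longrightarrow>
    robust n \<Sigma> Z f (1/3) M \<rho>\<^sub>0 \<rho>\<^sub>1 \<longrightarrow>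
    max \<rho>\<^sub>0 \<rho>\<^sub>1 \<ge> \<rho> \<longrightarrow>
    (\<exists>(q :: nat) (\<gamma> :: real).
       1 \<le> q \<and> real q \<le> l_log_l_bound C l \<and>
       0 \<le> \<gamma> \<and> \<gamma> \<le> D * (real (card \<Sigma>) ^ q * ln (real (card \<Sigma>))) \<and>
       (\<exists>p N. sample_based_algorithm n f (\<gamma> * real n powr (1 - 1 / (2 * (real q)\<^sup>2))) (1/3) p N))"
proof -
  define c where "c = 13824 * max 1 (1 / \<rho>)"
  have c: "13824 \<le> c" "13824 / \<rho> \<le> c" by (auto simp: c_def max_def field_simps)
  show ?thesis
  proof (rule exI[of _ 6], rule exI[of _ "24 * c"], intro allI impI)
    fix n l :: nat and \<Sigma> :: "'a set" and Z :: "'z set" and f M and \<rho>\<^sub>0 \<rho>\<^sub>1 :: real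
    assume fin: "finite \<Sigma>" and pf: "partial_fun n \<Sigma> Z f"
      and alg: "local_algorithm n \<Sigma> Z f l (1/3) M"
      and rob: "robust n \<Sigma> Z f (1/3) M \<rho>\<^sub>0 \<rho>\<^sub>1" and max: "max \<rho>\<^sub>0 \<rho>\<^sub>1 \<ge> \<rho>"
    define L where "L = Orderings.max 2 l"
    define q where "q = 3 * L"
    \<comment> \<open>In 24 = 12 * 2, the 12 comes from the cap \<open>12 * n * p\<close> and the 2
      from the factor \<open>2 * ln\<close> in \<open>p\<close>.\<close>
    define \<gamma> where "\<gamma> = 24 * c * (real (card \<Sigma>) ^ q * ln (real (card \<Sigma>)))"
    define s where "s = \<gamma> * real n powr (1 - 1 / (2 * (real q)\<^sup>2))"
    have L: "2 \<le> L" "l \<le> L" by (auto simp: L_def)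
    \<comment> \<open>The constant 6 works because \<open>ln L\<close> is at least 1/2.\<close>
    have q: "real q \<le> l_log_l_bound 6 l"
      using half_le_ln[OF L(1)] mult_left_mono[of "1/2" "ln (real L)" "6 * real L"]
      by (simp add: l_log_l_bound_def q_def L_def)
    have lnS: "0 \<le> ln (real (card \<Sigma>))" by (cases "card \<Sigma>") auto
    then have \<gamma>: "0 \<le> \<gamma>" using c by (simp add: \<gamma>_def)
    have s: "0 \<le> s" using \<gamma> by (simp add: s_def)
    have "\<exists>p N. sample_based_algorithm n f s (1/3) p N"
    proof (cases "n = 0 \<or> card \<Sigma> \<le> 1")
      case True
      \<comment> \<open>At most one string exists here, so nothing has to be sampled.\<close>
      obtain x0 where x0: "\<And>x. x \<in> strings n \<Sigma> \<Longrightarrow> x0 = x"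
      proof -
        have "x = y" if "x \<in> strings n \<Sigma>" "y \<in> strings n \<Sigma>" for x y
          using that True fin unfolding strings_def
          by (intro PiE_ext) (auto simp: card_le_Suc0_iff_eq)
        then show thesis using that by (cases "strings n \<Sigma> = {}") blast+
      qed
      show ?thesis
        by (intro exI[of _ 0] sample_based_algorithm_reconstruct[OF pf, where g = "\<lambda>_. x0" and Q = "{}"])
          (use x0 s in \<open>auto simp: random_subset_0\<close>)
    next
      case nontrivial: False
      show ?thesis
      \<comment> \<open>If the budget covers all coordinates, read everything. Otherwise
        \<open>s = 12 * n * p\<close> is below \<open>n\<close>, which gives
        \<open>p \<le> 1\<close>.\<close>
      proof (cases "real n \<le> s")
        case True
        have "(\<lambda>i. if i < n then the (((Some \<circ> x) |` {..<n}) i) else undefined) = x"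
          if "x \<in> strings n \<Sigma>" for x
          using that by (auto simp: strings_def PiE_def extensional_def fun_eq_iff)
        then show ?thesis using True
          by (intro exI[of _ 1] sample_based_algorithm_reconstruct[OF pf, where Q = "{..<n}" and
                g = "\<lambda>m i. if i < n then the (m i) else undefined"])
            (auto simp: random_subset_1)
      next
        case False
        define b where "b \<longleftrightarrow> \<rho>\<^sub>1 \<ge> \<rho>"
        define p where "p = c * real (card \<Sigma>) ^ (3 * L) * (2 * ln (real (card \<Sigma>))) *
          real n powr (- 1 / (18 * (real L)\<^sup>2))"
        have n: "0 < n" and card: "2 \<le> card \<Sigma>" using nontrivial by auto
        have exponent: "1 - 1 / (2 * (real q)\<^sup>2) = 1 + (- 1 / (18 * (real L)\<^sup>2))"
          by (simp add: q_def power_mult_distrib)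
        have s_eq: "s = 12 * real n * p"
          unfolding s_def exponent powr_add using n by (simp add: p_def \<gamma>_def q_def)
        have p1: "p \<le> 1" using False s_eq n by (simp add: not_le)
        have radius: "\<rho> \<le> (if b then \<rho>\<^sub>1 else \<rho>\<^sub>0)" using max by (auto simp: b_def max_def split: if_splits)
        have "\<exists>N. sample_based_algorithm n f (12 * real n * p) (1/3) p N"
        proof (rule sample_based_algorithm_of_robust[OF fin card n L pf alg _ assms c p_def p1])
          fix z x w assume f: "f (z, x) = Some b" and w: "w \<in> strings n \<Sigma>"
            and d: "real (card {i. i < n \<and> x i \<noteq> w i}) \<le> \<rho> * real n"
          have "z \<in> Z" using f pf by (auto simp: partial_fun_def)
          then have r: "robust_at n \<Sigma> {z} f (1/3) M (if b then \<rho>\<^sub>1 else \<rho>\<^sub>0) x"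
            using rob f unfolding robust_def by blast
          have "rel_dist n x w \<le> \<rho>" using d n by (simp add: rel_dist_def pos_divide_le_eq)
          then have "w \<in> string_ball n \<Sigma> (if b then \<rho>\<^sub>1 else \<rho>\<^sub>0) x"
            using w radius by (simp add: string_ball_def)
          then have "1 - 1/3 \<le> output_prob M z w b" using r f unfolding robust_at_def by blast
          then show "2/3 \<le> output_prob M z w b" by simp
        qed
        then show ?thesis using s_eq by auto
      qed
    qed
    then show "\<exists>(q :: nat) (\<gamma> :: real).
       1 \<le> q \<and> real q \<le> l_log_l_bound 6 l \<and>
       0 \<le> \<gamma> \<and> \<gamma> \<le> 24 * c * (real (card \<Sigma>) ^ q * ln (real (card \<Sigma>))) \<and>
       (\<exists>p N. sample_based_algorithm n f (\<gamma> * real n powr (1 - 1 / (2 * (real q)\<^sup>2))) (1/3) p N)"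
      using q \<gamma> L unfolding s_def
      by (intro exI[of _ q] exI[of _ \<gamma>]) (auto simp: \<gamma>_def q_def)
  qed
qed

end
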